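(* Suppose there is an infinite sum $\sum_{k=1}^{\infty} k^{s}z^{k}$, where $k$ and $z\in\mathbb{R}$. Then this sum can be expressed as $$\left(\frac{1}{\ln z}\right)^{s}\frac{d^{s}}{dx^{s}}\left(\frac{1}{1-z^{x}}\right)\bigg|_{x=1}.$$
   Context: Here $k$ is the summation index, $s$ is the exponent of $k$ in the sum and also the order of the derivative, $\ln$ is the natural logarithm, and $x$ is an auxiliary variable. The notation $\frac{d^{s}}{dx^{s}}(\cdot)\big|_{x=1}$ denotes the $s$-th derivative with respect to $x$, evaluated at $x=1$.
   Formalization: Proved for integers s ≥ 1 and real 0 < z < 1: for s = 0 the formula fails (z = 1/2 gives sum 1 but right side 2), for z ≤ 0 the real ln z is undefined, at z = 1 the factor 1/ln z is undefined, and for z > 1 the sum diverges. *)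

theory Defs
  imports "HOL-Analysis.Analysis"
begin

end

theory Submission
  imports Defs
begin

text \<open>
  On the power series \<open>\<Sum>n. n ^ s * y ^ n\<close> the Euler operator \<open>y \<cdot> d/dy\<close> raises the exponent
  \<open>s\<close> by one (\<open>weighted_geometric_has_derivative\<close>). Under the substitution \<open>y = z powr x\<close>, the
  operator \<open>d/dx\<close> becomes \<open>ln z \<cdot> y \<cdot> d/dy\<close>. Starting from the geometric series
  \<open>1 / (1 - z powr x)\<close>, which is the case \<open>s = 0\<close>, each differentiation in \<open>x\<close> therefore
  contributes one factor \<open>ln z\<close> and one factor \<open>n\<close> (\<open>higher_deriv_geometric_powr\<close>). Setting
  \<open>x = 1\<close> and dividing by \<open>(ln z) ^ s\<close> gives the sum.
\<close>

lemma summable_weighted_geometric: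
  fixes y :: "'a::{real_normed_field,banach}"
  assumes "norm y < 1"
  shows "summable (\<lambda>n. of_nat n ^ s * y ^ n)"
  using assms
proof (induction s arbitrary: y)
  case 0
  then show ?case by (simp add: summable_geometric)
next
  case (Suc s)
  have "summable (\<lambda>n. diffs (\<lambda>n. of_nat n ^ s) n * y ^ n)"
    by (rule termdiff_converges[OF Suc.prems Suc.IH])
  then have "summable (\<lambda>n. diffs (\<lambda>n. of_nat n ^ s) n * y ^ n * y)"
    by (rule summable_mult2)
  then have "summable (\<lambda>n. of_nat (Suc n) ^ Suc s * y ^ Suc n)"
    by (simp add: diffs_def mult_ac del: of_nat_Suc)
  then show ?case by (subst (asm) summable_Suc_iff)
qed

text \<open>
  In the Euler operator form \<open>y * D\<close>, the index shift of termwise differentiation is undone by the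
  factor \<open>y\<close>, so that the differentiated series is again of the same family.
\<close>

lemma weighted_geometric_has_derivative:
  fixes y :: "'a::{real_normed_field,banach}"
  assumes "norm y < 1"
  obtains D where "((\<lambda>y. \<Sum>n. of_nat n ^ s * y ^ n) has_field_derivative D) (at y)"
    and "y * D = (\<Sum>n. of_nat n ^ Suc s * y ^ n)"
proof
  let ?c = "\<lambda>n. of_nat n ^ s :: 'a"
  show "((\<lambda>y. \<Sum>n. ?c n * y ^ n) has_field_derivative (\<Sum>n. diffs ?c n * y ^ n)) (at y)"
    by (rule termdiffs_strong'[OF summable_weighted_geometric assms])
  have "summable (\<lambda>n. diffs ?c n * y ^ n)"
    by (rule termdiff_converges[OF assms summable_weighted_geometric])
  then have "y * (\<Sum>n. diffs ?c n * y ^ n) = (\<Sum>n. y * (diffs ?c n * y ^ n))"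
    by (rule suminf_mult[symmetric])
  also have "\<dots> = (\<Sum>n. of_nat (Suc n) ^ Suc s * y ^ Suc n)"
    by (simp add: diffs_def mult_ac del: of_nat_Suc)
  also have "\<dots> = (\<Sum>n. of_nat n ^ Suc s * y ^ n)"
    using suminf_split_head[OF summable_weighted_geometric[OF assms, of "Suc s"]] by simp
  finally show "y * (\<Sum>n. diffs ?c n * y ^ n) = (\<Sum>n. of_nat n ^ Suc s * y ^ n)" .
qed

text \<open>
  The identity is needed at every \<open>x > 0\<close>, not only at one point, because the inductive step
  differentiates it. Positivity of \<open>x\<close> is what keeps \<open>z powr x\<close> inside the disc of convergence.
\<close>

lemma higher_deriv_geometric_powr:
  fixes z x :: real
  assumes z: "0 < z" "z < 1" and "0 < x"
  shows "(deriv ^^ s) (\<lambda>x. 1 / (1 - z powr x)) x = ln z ^ s * (\<Sum>n. real n ^ s * (z powr x) ^ n)"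
  using \<open>0 < x\<close>
proof (induction s arbitrary: x)
  case 0
  then have "\<bar>z powr x\<bar> < 1"
    using z powr_less_mono'[of z 0 x] by simp
  then show ?case by (simp add: suminf_geometric)
next
  case (Suc s)
  let ?P = "\<lambda>y. \<Sum>n. real n ^ s * y ^ n"
  have "norm (z powr x) < 1"
    using Suc.prems z powr_less_mono'[of z 0 x] by simp
  then obtain D where D: "(?P has_field_derivative D) (at (z powr x))"
    and euler: "z powr x * D = (\<Sum>n. real n ^ Suc s * (z powr x) ^ n)"
    by (rule weighted_geometric_has_derivative)
  have "((\<lambda>x. z powr x) has_field_derivative ln z * z powr x) (at x)"
    using z by (auto intro!: derivative_eq_intros)
  then have "((\<lambda>x. ln z ^ s * ?P (z powr x)) has_field_derivative
      ln z ^ s * (D * (ln z * z powr x))) (at x)"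
    by (intro DERIV_cmult DERIV_chain2[where g = "\<lambda>x. z powr x", OF D])
  then have "((deriv ^^ s) (\<lambda>x. 1 / (1 - z powr x)) has_field_derivative
      ln z ^ s * (D * (ln z * z powr x))) (at x)"
    by (rule has_field_derivative_transform_within_open[of _ _ _ "{0<..}"])
      (use Suc in auto)
  then have "(deriv ^^ Suc s) (\<lambda>x. 1 / (1 - z powr x)) x = ln z ^ Suc s * (z powr x * D)"
    by (simp add: DERIV_imp_deriv mult_ac)
  then show ?case by (simp only: euler)
qed

theorem theorem1:
  fixes z :: real and s :: nat
  assumes "0 < z" and "z < 1" and "s \<ge> 1"
  shows "(\<lambda>k. real (Suc k) ^ s * z ^ Suc k) sums
           ((1 / ln z) ^ s * (deriv ^^ s) (\<lambda>x::real. 1 / (1 - z powr x)) 1)"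
proof -
  let ?S = "\<Sum>n. real n ^ s * z ^ n"
  have "(\<lambda>n. real n ^ s * z ^ n) sums ?S"
    using assms by (intro summable_sums summable_weighted_geometric) simp
  \<comment> \<open>Since \<open>s \<ge> 1\<close>, the term at \<open>n = 0\<close> is \<open>0\<close> rather than \<open>0 ^ 0 = 1\<close>.\<close>
  then have "(\<lambda>k. real (Suc k) ^ s * z ^ Suc k) sums ?S"
    using assms by (subst sums_Suc_iff) (simp add: power_0_left)
  moreover have "(1 / ln z) ^ s * (deriv ^^ s) (\<lambda>x. 1 / (1 - z powr x)) 1 = ?S"
    using assms by (simp add: higher_deriv_geometric_powr power_one_over)
  ultimately show ?thesis by (simp only:)
qed

end
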